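(* Let $A\in\mathbb{R}^{n\times n}$ and $b\in\mathbb{R}^n$ satisfy $\operatorname{sym}(A)\succeq I$, and suppose the solution set $S=\{x\in\mathbb{R}^n:\Phi(x)=0\}$ of $\Phi(x):=Ax-|x|-b=0$ is nonempty. Let $0<\rho<1$, $\epsilon>0$, $x^0\in\mathbb{R}^n$, and let $(x^k)$ be the iterates of the CPPC method described in the context, with constants $C_R$, $C_\Phi$, $\gamma_*$ as defined there. Then for every $x^*\in S$ and every integer $K\ge0$, $$\min_{0\le k\le K}\|R(x^k)\|_\infty\le\frac{C_\Phi\|x^0-x^*\|}{(1-\rho)\gamma_*\sqrt{K+1}},$$ $$\min_{0\le k\le K}\|Ax^k-|x^k|-b\|\le\frac{C_RC_\Phi\|x^0-x^*\|}{(1-\rho)\gamma_*\sqrt{K+1}}.$$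
   Context: $|x|$ is the componentwise absolute value; $\langle\cdot,\cdot\rangle$, $\|\cdot\|$ are the Euclidean inner product and norm; $\|\cdot\|_\infty$ is the maximum norm; $e_i$ is the $i$th coordinate vector; $\operatorname{sym}(A)=(A+A^\top)/2$; $I$ is the identity; $M\succeq N$ means $M-N$ is positive semidefinite. For $t\in\mathbb{R}$ put $t^-=\max\{-t,0\}$ and $g(t)=(t^-)^2$. Let $F(x)=(A-I)x-b$. Given $0<\rho<1$ and $\epsilon>0$, set $\ell_i=\max\{a_{ii}-1,\epsilon\}$ and $\gamma_i=\rho/\ell_i$ for $i=1,\dots,n$. For $\gamma>0$ and $z\in\mathbb{R}$, $\operatorname{prox}_{\gamma g}(z)=\arg\min_{t\in\mathbb{R}}\{g(t)+(2\gamma)^{-1}|t-z|^2\}$; explicitly, $\operatorname{prox}_{\gamma g}(z)=z$ if $z\ge0$ and $z/(1+2\gamma)$ if $z<0$. The coordinate proximal residual is $R(x)=(R_i(x))_{i=1}^n$ with $R_i(x)=\gamma_i^{-1}\bigl[x_i-\operatorname{prox}_{\gamma_i g}(x_i-\gamma_iF_i(x))\bigr]$. CPPC method: from an arbitrary $x^0\in\mathbb{R}^n$, for $k=0,1,2,\dots$: choose any $i_k\in\arg\max_{1\le i\le n}|R_i(x^k)|$. If $R_{i_k}(x^k)=0$, terminate and return $x^k$. Otherwise define $y^k$ by $y^k_j=x^k_j$ for $j\ne i_k$ and $y^k_{i_k}=\operatorname{prox}_{\gamma_{i_k}g}(x^k_{i_k}-\gamma_{i_k}F_{i_k}(x^k))$;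 set $d^k=x^k-y^k$, $v^k=\Phi(y^k)$, $\lambda_k=\langle v^k,d^k\rangle/\|v^k\|^2$, and $x^{k+1}=x^k-\lambda_kv^k$. If the method terminates at $x^k$, set $x^j=x^k$ for all $j>k$. Constants: $C_R=\bigl(\sum_{i=1}^n(1+2\gamma_i)^2\bigr)^{1/2}$, $C_S=\max_i\gamma_i(\|Ae_i\|+1)$, $C_\Phi=C_R+C_S$, $\gamma_*=\min_i\gamma_i$. *)

theory Defs
  imports "HOL-Analysis.Analysis"
begin

text \<open>On vectors, \<open>\<bar>x\<bar>\<close> is the library's componentwise absolute value (\<open>abs_vec_def\<close>),
  and \<open>infnorm\<close> is the maximum norm.\<close>

definition sym_part :: "real^'n^'n \<Rightarrow> real^'n^'n" where
  "sym_part A = (1/2) *\<^sub>R (A + transpose A)"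

definition psd :: "real^'n^'n \<Rightarrow> bool" where
  "psd M \<longleftrightarrow> transpose M = M \<and> (\<forall>x. 0 \<le> x \<bullet> (M *v x))"

definition loewner_ge :: "real^'n^'n \<Rightarrow> real^'n^'n \<Rightarrow> bool" where
  "loewner_ge M N \<longleftrightarrow> psd (M - N)"

definition Phi :: "real^'n^'n \<Rightarrow> real^'n \<Rightarrow> real^'n \<Rightarrow> real^'n" where
  "Phi A b x = A *v x - \<bar>x\<bar> - b"

definition solution_set :: "real^'n^'n \<Rightarrow> real^'n \<Rightarrow> (real^'n) set" where
  "solution_set A b = {x. Phi A b x = 0}"

definition neg_part :: "real \<Rightarrow> real" where
  "neg_part t = max (- t) 0"

definition neg_sq :: "real \<Rightarrow> real" where
  "neg_sq t = (neg_part t)\<^sup>2"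

definition Fmap :: "real^'n^'n \<Rightarrow> real^'n \<Rightarrow> real^'n \<Rightarrow> real^'n" where
  "Fmap A b x = (A - mat 1) *v x - b"

text \<open>\<open>prox \<gamma> g\<close> is the proximal map of \<open>\<gamma> g\<close>. It is meaningful only where the minimizer exists
  and is unique; for \<open>g = neg_sq\<close> and \<open>\<gamma> > 0\<close> see \<open>prox_neg_sq\<close> below.\<close>

definition prox :: "real \<Rightarrow> (real \<Rightarrow> real) \<Rightarrow> real \<Rightarrow> real" where
  "prox \<gamma> g z = (ARG_MIN (\<lambda>t. g t + inverse (2 * \<gamma>) * \<bar>t - z\<bar>\<^sup>2) t. True)"

definition stepsize :: "real^'n^'n \<Rightarrow> real \<Rightarrow> real \<Rightarrow> 'n \<Rightarrow> real" where
  "stepsize A \<rho> \<epsilon> i = \<rho> / max (A $ i $ i - 1) \<epsilon>"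

definition prox_coord ::
    "real^'n^'n \<Rightarrow> real^'n \<Rightarrow> real \<Rightarrow> real \<Rightarrow> real^'n \<Rightarrow> 'n \<Rightarrow> real" where
  "prox_coord A b \<rho> \<epsilon> x i =
     prox (stepsize A \<rho> \<epsilon> i) neg_sq (x $ i - stepsize A \<rho> \<epsilon> i * Fmap A b x $ i)"

definition residual ::
    "real^'n^'n \<Rightarrow> real^'n \<Rightarrow> real \<Rightarrow> real \<Rightarrow> real^'n \<Rightarrow> real^'n" where
  "residual A b \<rho> \<epsilon> x =
     (\<chi> i. inverse (stepsize A \<rho> \<epsilon> i) * (x $ i - prox_coord A b \<rho> \<epsilon> x i))"

text \<open>One iteration from \<open>x\<close> to \<open>x'\<close>, for some admissible choice of the coordinate \<open>i\<close>.
  Termination is encoded by \<open>x' = x\<close>: if \<open>residual x $ i = 0\<close> at a maximizing \<open>i\<close>, the residual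
  vanishes, so every later step is again \<open>x' = x\<close>.\<close>

definition cppc_step ::
    "real^'n^'n \<Rightarrow> real^'n \<Rightarrow> real \<Rightarrow> real \<Rightarrow> real^'n \<Rightarrow> real^'n \<Rightarrow> bool" where
  "cppc_step A b \<rho> \<epsilon> x x' \<longleftrightarrow>
     (\<exists>i. is_arg_max (\<lambda>j. \<bar>residual A b \<rho> \<epsilon> x $ j\<bar>) (\<lambda>_. True) i \<and>
       (if residual A b \<rho> \<epsilon> x $ i = 0 then x' = x
        else
          (let y = (\<chi> j. if j = i then prox_coord A b \<rho> \<epsilon> x i else x $ j);
               d = x - y;
               v = Phi A b y;
               l = (v \<bullet> d) / (norm v)\<^sup>2
           in x' = x - l *\<^sub>R v)))"

definition cppc_iterates ::
    "real^'n^'n \<Rightarrow> real^'n \<Rightarrow> real \<Rightarrow> real \<Rightarrow> real^'n \<Rightarrow> (nat \<Rightarrow> real^'n) \<Rightarrow> bool" where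
  "cppc_iterates A b \<rho> \<epsilon> x0 x \<longleftrightarrow>
     x 0 = x0 \<and> (\<forall>k. cppc_step A b \<rho> \<epsilon> (x k) (x (Suc k)))"

definition C_R :: "real^'n^'n \<Rightarrow> real \<Rightarrow> real \<Rightarrow> real" where
  "C_R A \<rho> \<epsilon> = sqrt (\<Sum>i\<in>UNIV. (1 + 2 * stepsize A \<rho> \<epsilon> i)\<^sup>2)"

definition C_S :: "real^'n^'n \<Rightarrow> real \<Rightarrow> real \<Rightarrow> real" where
  "C_S A \<rho> \<epsilon> = (MAX i. stepsize A \<rho> \<epsilon> i * (norm (A *v axis i 1) + 1))"

definition C_Phi :: "real^'n^'n \<Rightarrow> real \<Rightarrow> real \<Rightarrow> real" where
  "C_Phi A \<rho> \<epsilon> = C_R A \<rho> \<epsilon> + C_S A \<rho> \<epsilon>"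

definition gamma_min :: "real^'n^'n \<Rightarrow> real \<Rightarrow> real \<Rightarrow> real" where
  "gamma_min A \<rho> \<epsilon> = (MIN i. stepsize A \<rho> \<epsilon> i)"

lemma prox_neg_sq:
  assumes "0 < \<gamma>"
  shows "prox \<gamma> neg_sq z = (if 0 \<le> z then z else z / (1 + 2 * \<gamma>))"
proof -
  define p where "p = (if 0 \<le> z then z else z / (1 + 2 * \<gamma>))"
  define f where "f = (\<lambda>t. neg_sq t + inverse (2 * \<gamma>) * \<bar>t - z\<bar>\<^sup>2)"
  have key: "f p + inverse (2 * \<gamma>) * (t - p)\<^sup>2 \<le> f t" for t
  proof (cases "0 \<le> z")
    case True
    then show ?thesis by (simp add: f_def p_def neg_sq_def neg_part_def)
  next
    case False
    then have z: "z = p * (1 + 2 * \<gamma>)" and p: "p < 0"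
      using assms by (auto simp: p_def divide_neg_pos)
    have eq: "inverse (2 * \<gamma>) * (t - z)\<^sup>2
        = inverse (2 * \<gamma>) * (t - p)\<^sup>2 + inverse (2 * \<gamma>) * (p - z)\<^sup>2 - 2 * p * (t - p)"
      using assms by (simp add: z field_simps power2_eq_square)
    have "p\<^sup>2 + 2 * p * (t - p) \<le> neg_sq t"
    proof (cases "0 \<le> t")
      case True
      have "p\<^sup>2 + 2 * p * (t - p) = 2 * (p * t) - p\<^sup>2"
        by (simp add: algebra_simps power2_eq_square)
      moreover have "p * t \<le> 0" using True p by (simp add: mult_nonpos_nonneg)
      moreover have "neg_sq t = 0" using True by (simp add: neg_sq_def neg_part_def)
      ultimately show ?thesis using zero_le_power2[of p] by linarith
    next
      case False
      then have "neg_sq t - (p\<^sup>2 + 2 * p * (t - p)) = (t - p)\<^sup>2"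
        by (simp add: neg_sq_def neg_part_def algebra_simps power2_eq_square)
      then show ?thesis using zero_le_power2[of "t - p"] by linarith
    qed
    moreover have "neg_sq p = p\<^sup>2" using p by (simp add: neg_sq_def neg_part_def)
    ultimately show ?thesis using eq unfolding f_def power2_abs by linarith
  qed
  have "f p \<le> f t" for t
    using key[of t] assms by (smt (verit) inverse_nonnegative_iff_nonnegative mult_nonneg_nonneg zero_le_power2)
  then have "f (arg_min f (\<lambda>_. True)) = f p"
    by (intro arg_min_equality) auto
  with key[of "arg_min f (\<lambda>_. True)"]
  have "inverse (2 * \<gamma>) * (arg_min f (\<lambda>_. True) - p)\<^sup>2 \<le> 0" by simp
  then have "arg_min f (\<lambda>_. True) = p"
    using assms by (simp add: mult_le_0_iff)
  then show ?thesis by (simp add: prox_def f_def p_def)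
qed

end

theory Submission
  imports Defs
begin

text \<open>The derivative of \<open>g\<close> is \<open>t - \<bar>t\<bar>\<close>, so \<open>\<Phi> = F + g'\<close> componentwise, and \<open>\<Phi>\<close> is monotone.
  The optimality condition of the prox gives \<open>R\<^sub>i(x) = F\<^sub>i(x) + g'(p)\<close> with \<open>p\<close> the prox point.
  Hence \<open>\<Phi>\<^sub>i(y) = (1 - \<gamma>\<^sub>i (a\<^sub>i\<^sub>i - 1)) R\<^sub>i(x)\<close> and
  \<open>\<langle>\<Phi>(y), d\<rangle> \<ge> (1 - \<rho>) \<gamma>\<^sub>* \<parallel>R(x)\<parallel>\<^sub>\<infinity>\<^sup>2\<close>, while \<open>\<parallel>\<Phi>(y)\<parallel> \<le> C\<^sub>\<Phi> \<parallel>R(x)\<parallel>\<^sub>\<infinity>\<close>.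
  By monotonicity the step is a projection onto a hyperplane whose half-space contains the
  solutions, so \<open>\<parallel>x\<^sup>k - x\<^sup>*\<parallel>\<^sup>2\<close> drops by at least a multiple of \<open>\<parallel>R(x\<^sup>k)\<parallel>\<^sub>\<infinity>\<^sup>2\<close>; telescoping concludes.\<close>

text \<open>The first-order condition \<open>p + \<gamma> * g'(p) = z\<close>, read off from the
  closed form: for \<open>z < 0\<close> the prox point is negative and the slope there is
  \<open>2 * p\<close>.\<close>

lemma prox_neg_sq_optimality:
  assumes "0 < \<gamma>"
  shows "prox \<gamma> neg_sq z + \<gamma> * (prox \<gamma> neg_sq z - \<bar>prox \<gamma> neg_sq z\<bar>) = z"
proof (cases "0 \<le> z")
  case True
  then show ?thesis using assms by (simp add: prox_neg_sq)
next
  case False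
  define p where "p = z / (1 + 2 * \<gamma>)"
  have "p < 0" "z = p * (1 + 2 * \<gamma>)"
    using False assms by (auto simp: p_def divide_neg_pos)
  then show ?thesis using False assms
    by (simp add: prox_neg_sq flip: p_def) (simp add: algebra_simps)
qed

section \<open>Monotonicity of \<open>Phi\<close>\<close>

lemma inner_sym_part:
  fixes A :: "real^'n^'n"
  shows "x \<bullet> (sym_part A *v x) = x \<bullet> (A *v x)"
proof -
  have "x \<bullet> (transpose A *v x) = x \<bullet> (A *v x)"
    by (metis dot_lmul_matrix inner_commute transpose_matrix_vector)
  then show ?thesis
    by (simp add: sym_part_def scaleR_matrix_vector_assoc [symmetric] matrix_vector_mult_add_rdistrib
        inner_add_right)
qed

lemma loewner_ge_sym_part_inner:
  fixes A :: "real^'n^'n"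
  assumes "loewner_ge (sym_part A) (mat 1)"
  shows "x \<bullet> x \<le> x \<bullet> (A *v x)"
proof -
  have "0 \<le> x \<bullet> ((sym_part A - mat 1) *v x)"
    using assms by (simp add: loewner_ge_def psd_def)
  then show ?thesis
    by (simp add: matrix_vector_mult_diff_rdistrib inner_diff_right inner_sym_part)
qed

lemma abs_vec_nth: "\<bar>x :: real^'n\<bar> $ i = \<bar>x $ i\<bar>"
  by (simp add: abs_vec_def)

lemma norm_abs_diff_vec_le: "norm (\<bar>x\<bar> - \<bar>y\<bar>) \<le> norm (x - y :: real^'n)"
  by (rule norm_le_componentwise_cart) (simp add: abs_vec_nth abs_triangle_ineq3)

text \<open>The quadratic form of \<open>A\<close> dominates the squared norm, and that absorbs the
  componentwise absolute value because this map is 1-Lipschitz.\<close>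

lemma Phi_monotone:
  fixes A :: "real^'n^'n"
  assumes "loewner_ge (sym_part A) (mat 1)"
  shows "0 \<le> (Phi A b x - Phi A b y) \<bullet> (x - y)"
proof -
  have "(\<bar>x\<bar> - \<bar>y\<bar>) \<bullet> (x - y) \<le> norm (\<bar>x\<bar> - \<bar>y\<bar>) * norm (x - y)"
    by (rule norm_cauchy_schwarz)
  also have "\<dots> \<le> norm (x - y) * norm (x - y)"
    by (intro mult_right_mono norm_abs_diff_vec_le) auto
  also have "\<dots> = (x - y) \<bullet> (x - y)"
    by (simp add: power2_norm_eq_inner flip: power2_eq_square)
  also have "\<dots> \<le> (x - y) \<bullet> (A *v (x - y))"
    by (rule loewner_ge_sym_part_inner[OF assms])
  finally have "(\<bar>x\<bar> - \<bar>y\<bar>) \<bullet> (x - y) \<le> (A *v (x - y)) \<bullet> (x - y)"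
    by (simp add: inner_commute)
  moreover have "Phi A b x - Phi A b y = A *v (x - y) - (\<bar>x\<bar> - \<bar>y\<bar>)"
    by (simp add: Phi_def matrix_vector_mult_diff_distrib)
  ultimately show ?thesis by (simp add: inner_diff_left)
qed

lemma Phi_nth: "Phi A b x $ i = Fmap A b x $ i + (x $ i - \<bar>x $ i\<bar>)"
  by (simp add: Phi_def Fmap_def matrix_vector_mult_diff_rdistrib abs_vec_nth)

lemma component_le_infnorm_vec: "\<bar>x $ i\<bar> \<le> infnorm (x :: real^'n)"
  using component_le_infnorm_cart by blast

lemma infnorm_eq_arg_max:
  fixes x :: "real^'n"
  assumes "is_arg_max (\<lambda>j. \<bar>x $ j\<bar>) (\<lambda>_. True) i"
  shows "infnorm x = \<bar>x $ i\<bar>"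
proof -
  have "\<bar>x $ j\<bar> \<le> \<bar>x $ i\<bar>" for j
    using assms by (auto simp: is_arg_max_def not_less)
  then have "infnorm x \<le> \<bar>x $ i\<bar>"
    unfolding infnorm_cart by (intro cSup_least) auto
  then show ?thesis
    using component_le_infnorm_vec[of x i] by simp
qed

text \<open>The new point is the projection of \<open>x\<close> onto the hyperplane through
  \<open>y\<close> with normal \<open>v\<close>. Since \<open>x\<close> and \<open>z\<close> lie on
  opposite sides of it, Pythagoras gives the decrease.\<close>

lemma relaxed_projection_step:
  fixes v d y z x :: "'a::real_inner"
  assumes "0 \<le> v \<bullet> (y - z)" "d = x - y" "0 \<le> v \<bullet> d"
  shows "(norm (x - ((v \<bullet> d) / (norm v)\<^sup>2) *\<^sub>R v - z))\<^sup>2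
    \<le> (norm (x - z))\<^sup>2 - (v \<bullet> d)\<^sup>2 / (norm v)\<^sup>2"
proof (cases "v = 0")
  case False
  define l where "l = (v \<bullet> d) / (norm v)\<^sup>2"
  have "x - l *\<^sub>R v - z = (x - z) - l *\<^sub>R v" by simp
  then have "(norm (x - l *\<^sub>R v - z))\<^sup>2 = (norm (x - z))\<^sup>2 - 2 * l * (v \<bullet> (x - z)) + l\<^sup>2 * (norm v)\<^sup>2"
    unfolding power2_norm_eq_inner
    by (simp add: inner_diff_left inner_diff_right inner_commute power2_eq_square[of l] algebra_simps)
  \<comment> \<open>Here \<open>x - z = d + (y - z)\<close>, and the second summand has nonnegative
    inner product with \<open>v\<close>.\<close>
  moreover have "l * (v \<bullet> d) \<le> l * (v \<bullet> (x - z))"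
    using assms by (intro mult_left_mono) (auto simp: l_def inner_diff_right)
  moreover have "l * (v \<bullet> d) = (v \<bullet> d)\<^sup>2 / (norm v)\<^sup>2" "l\<^sup>2 * (norm v)\<^sup>2 = (v \<bullet> d)\<^sup>2 / (norm v)\<^sup>2"
    using False by (auto simp: l_def power2_eq_square)
  ultimately show ?thesis unfolding l_def[symmetric] by linarith
\<comment> \<open>For \<open>v = 0\<close> both quotients are 0 by the convention on division, and
  the two sides agree.\<close>
qed simp

section \<open>Step sizes and constants\<close>

context
  fixes A :: "real^'n^'n" and b :: "real^'n" and \<rho> \<epsilon> :: real
  assumes \<rho>: "0 < \<rho>" and \<epsilon>: "0 < \<epsilon>"
begin

lemma stepsize_pos: "0 < stepsize A \<rho> \<epsilon> i"
  using \<rho> \<epsilon> by (simp add: stepsize_def)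

text \<open>Keeps the factor \<open>1 - \<gamma> * (A $ i $ i - 1)\<close> of a coordinate step at
  least \<open>1 - \<rho>\<close>.\<close>

lemma stepsize_mult_diag_le: "stepsize A \<rho> \<epsilon> i * (A $ i $ i - 1) \<le> \<rho>"
proof -
  have "\<rho> * (A $ i $ i - 1) \<le> \<rho> * max (A $ i $ i - 1) \<epsilon>"
    using \<rho> by (intro mult_left_mono) auto
  then show ?thesis using \<epsilon> by (simp add: stepsize_def divide_le_eq)
qed

lemma gamma_min_pos: "0 < gamma_min A \<rho> \<epsilon>"
  unfolding gamma_min_def by (subst Min_gr_iff) (auto simp: stepsize_pos)

lemma gamma_min_le: "gamma_min A \<rho> \<epsilon> \<le> stepsize A \<rho> \<epsilon> i"
  unfolding gamma_min_def by (rule Min_le) auto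

lemma C_R_pos: "0 < C_R A \<rho> \<epsilon>"
  unfolding C_R_def real_sqrt_gt_0_iff
proof (rule sum_pos)
  show "0 < (1 + 2 * stepsize A \<rho> \<epsilon> i)\<^sup>2" for i
    using stepsize_pos[of i] by (intro zero_less_power) linarith
qed auto

lemma C_S_ge: "stepsize A \<rho> \<epsilon> i * (norm (A *v axis i 1) + 1) \<le> C_S A \<rho> \<epsilon>"
  unfolding C_S_def by (rule Max_ge) auto

lemma C_Phi_pos: "0 < C_Phi A \<rho> \<epsilon>"
proof -
  have "0 \<le> stepsize A \<rho> \<epsilon> i * (norm (A *v axis i 1) + 1)" for i
    using stepsize_pos[of i] by simp
  then have "0 \<le> C_S A \<rho> \<epsilon>" using C_S_ge order_trans by blast
  then show ?thesis using C_R_pos by (simp add: C_Phi_def)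
qed

section \<open>The residual compared with \<open>Phi\<close>\<close>

lemma diff_prox_coord:
  "x $ i - prox_coord A b \<rho> \<epsilon> x i = stepsize A \<rho> \<epsilon> i * residual A b \<rho> \<epsilon> x $ i"
  using stepsize_pos[of i] by (simp add: residual_def)

text \<open>Prox optimality divided by the step size: the residual is \<open>Phi\<close> with the
  slope of \<open>g\<close> taken at the prox point instead of at \<open>x $ i\<close>.\<close>

lemma residual_eq_Fmap_plus_slope:
  "residual A b \<rho> \<epsilon> x $ i
    = Fmap A b x $ i + (prox_coord A b \<rho> \<epsilon> x i - \<bar>prox_coord A b \<rho> \<epsilon> x i\<bar>)"
proof -
  let ?\<gamma> = "stepsize A \<rho> \<epsilon> i" and ?p = "prox_coord A b \<rho> \<epsilon> x i"
  have "?p + ?\<gamma> * (?p - \<bar>?p\<bar>) = x $ i - ?\<gamma> * Fmap A b x $ i"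
    using prox_neg_sq_optimality[OF stepsize_pos] by (simp add: prox_coord_def)
  then have "?\<gamma> * residual A b \<rho> \<epsilon> x $ i = ?\<gamma> * (Fmap A b x $ i + (?p - \<bar>?p\<bar>))"
    unfolding diff_prox_coord[symmetric] by (simp add: algebra_simps)
  then show ?thesis using stepsize_pos[of i] by simp
qed

text \<open>Only the point where the slope is taken differs. The slope
  \<open>t - \<bar>t\<bar>\<close> is 2-Lipschitz and the two points are
  \<open>\<gamma> * \<bar>R $ i\<bar>\<close> apart, whence the factor
  \<open>1 + 2 * \<gamma>\<close>.\<close>

lemma norm_Phi_le: "norm (Phi A b x) \<le> C_R A \<rho> \<epsilon> * infnorm (residual A b \<rho> \<epsilon> x)"
proof -
  let ?R = "residual A b \<rho> \<epsilon> x"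
  have "\<bar>Phi A b x $ i\<bar> \<le> (1 + 2 * stepsize A \<rho> \<epsilon> i) * infnorm ?R" for i
  proof -
    let ?p = "prox_coord A b \<rho> \<epsilon> x i"
    have "Phi A b x $ i = ?R $ i + ((x $ i - ?p) - (\<bar>x $ i\<bar> - \<bar>?p\<bar>))"
      by (simp add: Phi_nth residual_eq_Fmap_plus_slope)
    then have "\<bar>Phi A b x $ i\<bar> \<le> \<bar>?R $ i\<bar> + 2 * \<bar>x $ i - ?p\<bar>"
      using abs_triangle_ineq3[of "x $ i" ?p] by (smt (verit))
    also have "\<dots> = (1 + 2 * stepsize A \<rho> \<epsilon> i) * \<bar>?R $ i\<bar>"
      using stepsize_pos[of i] by (simp add: diff_prox_coord abs_mult algebra_simps)
    also have "\<dots> \<le> (1 + 2 * stepsize A \<rho> \<epsilon> i) * infnorm ?R"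
      using stepsize_pos[of i] by (intro mult_left_mono component_le_infnorm_vec) auto
    finally show ?thesis .
  qed
  then have "norm (Phi A b x) \<le> L2_set (\<lambda>i. (1 + 2 * stepsize A \<rho> \<epsilon> i) * infnorm ?R) UNIV"
    unfolding norm_vec_def by (intro L2_set_mono) auto
  also have "\<dots> = C_R A \<rho> \<epsilon> * infnorm ?R"
    by (simp add: C_R_def L2_set_def power_mult_distrib real_sqrt_mult infnorm_pos_le
        flip: sum_distrib_right)
  finally show ?thesis .
qed

section \<open>One coordinate step\<close>

lemma trial_point_eq:
  "(\<chi> j. if j = i then prox_coord A b \<rho> \<epsilon> x i else x $ j)
    = x - (stepsize A \<rho> \<epsilon> i * residual A b \<rho> \<epsilon> x $ i) *\<^sub>R axis i 1"
  by (simp add: vec_eq_iff axis_def flip: diff_prox_coord)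

text \<open>Moving by \<open>d\<close> changes \<open>Phi\<close> by at most
  \<open>norm (A *v d) + norm d\<close>; as \<open>d\<close> is a multiple of a coordinate vector,
  \<open>C_S\<close> bounds this change.\<close>

lemma norm_Phi_coordinate_step_le:
  fixes x :: "real^'n" and i :: 'n
  defines "d \<equiv> (stepsize A \<rho> \<epsilon> i * residual A b \<rho> \<epsilon> x $ i) *\<^sub>R axis i 1"
  shows "norm (Phi A b (x - d)) \<le> C_Phi A \<rho> \<epsilon> * infnorm (residual A b \<rho> \<epsilon> x)"
proof -
  let ?R = "residual A b \<rho> \<epsilon> x" and ?\<gamma> = "stepsize A \<rho> \<epsilon> i"
  have "Phi A b (x - d) = Phi A b x - (A *v d + (\<bar>x - d\<bar> - \<bar>x\<bar>))"
    by (simp add: Phi_def matrix_vector_mult_diff_distrib)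
  moreover have "norm (\<bar>x - d\<bar> - \<bar>x\<bar>) \<le> norm d"
    using norm_abs_diff_vec_le[of "x - d" x] by simp
  ultimately have "norm (Phi A b (x - d)) \<le> norm (Phi A b x) + (norm (A *v d) + norm d)"
    by (smt (verit) norm_triangle_ineq norm_triangle_ineq4)
  also have "norm (A *v d) + norm d = ?\<gamma> * (norm (A *v axis i 1) + 1) * \<bar>?R $ i\<bar>"
    using stepsize_pos[of i]
    by (simp add: d_def matrix_vector_mult_scaleR abs_mult algebra_simps)
  also have "\<dots> \<le> C_S A \<rho> \<epsilon> * infnorm ?R"
    using stepsize_pos[of i]
    by (intro mult_mono' C_S_ge component_le_infnorm_vec) auto
  finally show ?thesis
    using norm_Phi_le[of x] by (simp add: C_Phi_def distrib_right)
qed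

text \<open>Coordinate \<open>i\<close> of \<open>x - d\<close> is the prox point, so the slope is
  the one already in the residual; only the affine part \<open>Fmap\<close> changes.\<close>

lemma Phi_coordinate_step_nth:
  fixes x :: "real^'n" and i :: 'n
  defines "d \<equiv> (stepsize A \<rho> \<epsilon> i * residual A b \<rho> \<epsilon> x $ i) *\<^sub>R axis i 1"
  shows "Phi A b (x - d) $ i
    = (1 - stepsize A \<rho> \<epsilon> i * (A $ i $ i - 1)) * residual A b \<rho> \<epsilon> x $ i"
proof -
  let ?R = "residual A b \<rho> \<epsilon> x" and ?p = "prox_coord A b \<rho> \<epsilon> x i"
  have "(x - d) $ i = ?p"
    by (simp add: d_def flip: diff_prox_coord)
  moreover have "Fmap A b (x - d) $ i
      = Fmap A b x $ i - (stepsize A \<rho> \<epsilon> i * ?R $ i) * (A $ i $ i - 1)"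
    by (simp add: Fmap_def matrix_vector_mult_diff_distrib matrix_vector_mult_diff_rdistrib d_def
        matrix_vector_mult_scaleR matrix_vector_mult_basis column_def mat_def algebra_simps)
  ultimately have "Phi A b (x - d) $ i = ?R $ i - (stepsize A \<rho> \<epsilon> i * ?R $ i) * (A $ i $ i - 1)"
    by (simp only: Phi_nth residual_eq_Fmap_plus_slope)
  then show ?thesis by (simp add: algebra_simps)
qed

lemma cppc_step_decrease:
  assumes A: "loewner_ge (sym_part A) (mat 1)" and "\<rho> < 1"
    and step: "cppc_step A b \<rho> \<epsilon> x x'" and z: "z \<in> solution_set A b"
  shows "(norm (x' - z))\<^sup>2 + ((1 - \<rho>) * gamma_min A \<rho> \<epsilon> / C_Phi A \<rho> \<epsilon>)\<^sup>2 * (infnorm (residual A b \<rho> \<epsilon> x))\<^sup>2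
    \<le> (norm (x - z))\<^sup>2"
proof -
  let ?R = "residual A b \<rho> \<epsilon> x" and ?C = "C_Phi A \<rho> \<epsilon>"
  define c where "c = (1 - \<rho>) * gamma_min A \<rho> \<epsilon>"
  have c: "0 < c" using \<open>\<rho> < 1\<close> gamma_min_pos by (simp add: c_def)
  obtain i where i: "is_arg_max (\<lambda>j. \<bar>?R $ j\<bar>) (\<lambda>_. True) i"
    and x': "if ?R $ i = 0 then x' = x
        else (let y = (\<chi> j. if j = i then prox_coord A b \<rho> \<epsilon> x i else x $ j);
               d = x - y; v = Phi A b y; l = (v \<bullet> d) / (norm v)\<^sup>2
           in x' = x - l *\<^sub>R v)"
    using step unfolding cppc_step_def by blast
  have inf: "infnorm ?R = \<bar>?R $ i\<bar>" by (rule infnorm_eq_arg_max[OF i])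
  show ?thesis
  proof (cases "?R $ i = 0")
    \<comment> \<open>A zero at a maximizing index makes the whole residual vanish, so staying at
      \<open>x\<close> meets the bound.\<close>
    case True
    then show ?thesis using x' inf by simp
  next
    case False
    define d where "d = (stepsize A \<rho> \<epsilon> i * ?R $ i) *\<^sub>R (axis i 1 :: real^'n)"
    define v where "v = Phi A b (x - d)"
    have x'_eq: "x' = x - ((v \<bullet> d) / (norm v)\<^sup>2) *\<^sub>R v"
      using x' False by (simp add: trial_point_eq v_def d_def Let_def)
    have nv: "norm v \<le> ?C * infnorm ?R"
      unfolding v_def d_def by (rule norm_Phi_coordinate_step_le)
    have "v \<bullet> d = (stepsize A \<rho> \<epsilon> i * (1 - stepsize A \<rho> \<epsilon> i * (A $ i $ i - 1))) * (?R $ i)\<^sup>2"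
      using Phi_coordinate_step_nth[of x i, folded d_def v_def]
      by (simp add: d_def inner_axis power2_eq_square)
    moreover have "c \<le> stepsize A \<rho> \<epsilon> i * (1 - stepsize A \<rho> \<epsilon> i * (A $ i $ i - 1))"
      unfolding c_def using gamma_min_le[of i] gamma_min_pos stepsize_mult_diag_le[of i] \<open>\<rho> < 1\<close>
      by (subst mult.commute) (intro mult_mono, auto)
    ultimately have vd: "c * (infnorm ?R)\<^sup>2 \<le> v \<bullet> d"
      unfolding inf power2_abs by (simp add: mult_right_mono)
    \<comment> \<open>Strict positivity excludes \<open>v = 0\<close>, so that \<open>norm v\<close>
      can serve as a denominator.\<close>
    have "0 < c * (infnorm ?R)\<^sup>2" using c False inf by simp
    then have "0 < v \<bullet> d" using vd by linarith
    then have "v \<noteq> 0" by auto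
    have "infnorm ?R \<noteq> 0" using False inf by simp
    \<comment> \<open>The numerator is bounded below quadratically and the denominator above
      linearly in the residual, so the step length is at least linear in it.\<close>
    have "c / ?C * infnorm ?R = c * (infnorm ?R)\<^sup>2 / (?C * infnorm ?R)"
      using C_Phi_pos \<open>infnorm ?R \<noteq> 0\<close> by (simp add: power2_eq_square)
    also have "\<dots> \<le> (v \<bullet> d) / norm v"
      using vd nv \<open>v \<noteq> 0\<close> \<open>0 < v \<bullet> d\<close> by (intro frac_le) auto
    finally have "(c / ?C * infnorm ?R)\<^sup>2 \<le> ((v \<bullet> d) / norm v)\<^sup>2"
      using c C_Phi_pos by (intro power_mono) (auto simp: infnorm_pos_le)
    \<comment> \<open>Monotonicity with \<open>Phi A b z = 0\<close> places \<open>z\<close> in the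
      half-space.\<close>
    moreover have "0 \<le> v \<bullet> ((x - d) - z)"
      using Phi_monotone[OF A, of b "x - d" z] z by (simp add: v_def solution_set_def)
    then have "(norm (x' - z))\<^sup>2 \<le> (norm (x - z))\<^sup>2 - (v \<bullet> d)\<^sup>2 / (norm v)\<^sup>2"
      unfolding x'_eq using \<open>0 < v \<bullet> d\<close> by (intro relaxed_projection_step) auto
    ultimately show ?thesis
      by (simp add: c_def power_mult_distrib power_divide)
  qed
qed

end

section \<open>From decrease per step to a rate\<close>

lemma Min_le_of_telescoping_decrease:
  fixes a r :: "nat \<Rightarrow> real"
  assumes decr: "\<And>k. a (Suc k) + q\<^sup>2 * (r k)\<^sup>2 \<le> a k" and "\<And>k. 0 \<le> a k" "\<And>k. 0 \<le> r k" "0 < q"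
  shows "(MIN k\<in>{0..K}. r k) \<le> sqrt (a 0) / (q * sqrt (real K + 1))"
proof -
  define m where "m = (MIN k\<in>{0..K}. r k)"
  have m: "m \<le> r k" if "k \<le> K" for k
    unfolding m_def using that by (intro Min_le) auto
  have m0: "0 \<le> m"
    unfolding m_def using assms by (intro Min.boundedI) auto
  have "a (Suc j) + real (Suc j) * (q\<^sup>2 * m\<^sup>2) \<le> a 0" if "j \<le> K" for j
    using that
  proof (induction j)
    case 0
    have "q\<^sup>2 * m\<^sup>2 \<le> q\<^sup>2 * (r 0)\<^sup>2" using m[of 0] m0 by (intro mult_left_mono power_mono) auto
    then show ?case using decr[of 0] by simp
  next
    case (Suc j)
    have "q\<^sup>2 * m\<^sup>2 \<le> q\<^sup>2 * (r (Suc j))\<^sup>2"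
      using m[of "Suc j"] m0 Suc.prems by (intro mult_left_mono power_mono) auto
    then show ?case using decr[of "Suc j"] Suc by (simp add: algebra_simps)
  qed
  \<comment> \<open>The indices \<open>0\<close> to \<open>K\<close> contribute \<open>K + 1\<close>
    decreases of at least \<open>q\<^sup>2 * m\<^sup>2\<close>, all paid for by
    \<open>a 0\<close>.\<close>
  from this[of K] have "real (Suc K) * (q\<^sup>2 * m\<^sup>2) \<le> a 0"
    using assms(2)[of "Suc K"] by simp
  then have "(m * (q * sqrt (real K + 1)))\<^sup>2 \<le> a 0"
    by (simp add: power_mult_distrib algebra_simps)
  then have "m * (q * sqrt (real K + 1)) \<le> sqrt (a 0)"
    by (rule real_le_rsqrt)
  then show ?thesis using \<open>0 < q\<close> by (simp add: m_def pos_le_divide_eq)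
qed

theorem theorem4p4:
  fixes A :: "real^'n^'n" and b x0 :: "real^'n" and \<rho> \<epsilon> :: real
    and x :: "nat \<Rightarrow> real^'n"
  assumes "loewner_ge (sym_part A) (mat 1)"
    and "solution_set A b \<noteq> {}"
    and "0 < \<rho>" and "\<rho> < 1" and "0 < \<epsilon>"
    and "cppc_iterates A b \<rho> \<epsilon> x0 x"
  shows "\<forall>xs \<in> solution_set A b. \<forall>K::nat.
      (MIN k\<in>{0..K}. infnorm (residual A b \<rho> \<epsilon> (x k)))
        \<le> C_Phi A \<rho> \<epsilon> * norm (x0 - xs)
            / ((1 - \<rho>) * gamma_min A \<rho> \<epsilon> * sqrt (real K + 1)) \<and>
      (MIN k\<in>{0..K}. norm (A *v x k - \<bar>x k\<bar> - b))
        \<le> C_R A \<rho> \<epsilon> * C_Phi A \<rho> \<epsilon> * norm (x0 - xs)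
            / ((1 - \<rho>) * gamma_min A \<rho> \<epsilon> * sqrt (real K + 1))"
proof (intro ballI allI)
  fix xs K
  assume xs: "xs \<in> solution_set A b"
  let ?r = "\<lambda>k. infnorm (residual A b \<rho> \<epsilon> (x k))"
    and ?q = "(1 - \<rho>) * gamma_min A \<rho> \<epsilon> / C_Phi A \<rho> \<epsilon>"
  have x: "x 0 = x0" "\<And>k. cppc_step A b \<rho> \<epsilon> (x k) (x (Suc k))"
    using assms(6) by (auto simp: cppc_iterates_def)
  have "0 < ?q"
    using assms(4) by (intro divide_pos_pos mult_pos_pos gamma_min_pos[OF assms(3,5)] C_Phi_pos[OF assms(3,5)]) simp
  then have "(MIN k\<in>{0..K}. ?r k) \<le> sqrt ((norm (x 0 - xs))\<^sup>2) / (?q * sqrt (real K + 1))"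
    using cppc_step_decrease[OF assms(3,5,1,4) x(2) xs]
    by (intro Min_le_of_telescoping_decrease[where a = "\<lambda>k. (norm (x k - xs))\<^sup>2"])
      (auto simp: infnorm_pos_le)
  also have "\<dots> = C_Phi A \<rho> \<epsilon> * norm (x0 - xs) / ((1 - \<rho>) * gamma_min A \<rho> \<epsilon> * sqrt (real K + 1))"
    using x(1) by simp
  finally have bound: "(MIN k\<in>{0..K}. ?r k) \<le> \<dots>" .
  \<comment> \<open>An index attaining the smallest residual also witnesses the second bound, at the
    cost of a factor \<open>C_R\<close>.\<close>
  have "(MIN k\<in>{0..K}. ?r k) \<in> ?r ` {0..K}" by (intro Min_in) auto
  then obtain k where k: "(MIN k\<in>{0..K}. ?r k) = ?r k" "k \<in> {0..K}" by (rule imageE)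
  have "(MIN k\<in>{0..K}. norm (A *v x k - \<bar>x k\<bar> - b)) \<le> norm (A *v x k - \<bar>x k\<bar> - b)"
    using k(2) by (intro Min_le) auto
  also have "\<dots> \<le> C_R A \<rho> \<epsilon> * ?r k"
    using norm_Phi_le[OF assms(3,5)] by (simp add: Phi_def)
  also have "\<dots> \<le> C_R A \<rho> \<epsilon>
      * (C_Phi A \<rho> \<epsilon> * norm (x0 - xs) / ((1 - \<rho>) * gamma_min A \<rho> \<epsilon> * sqrt (real K + 1)))"
    using bound C_R_pos[OF assms(3,5), of A] unfolding k(1) by (intro mult_left_mono) auto
  finally show "(MIN k\<in>{0..K}. ?r k)
        \<le> C_Phi A \<rho> \<epsilon> * norm (x0 - xs)
            / ((1 - \<rho>) * gamma_min A \<rho> \<epsilon> * sqrt (real K + 1)) \<and>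
      (MIN k\<in>{0..K}. norm (A *v x k - \<bar>x k\<bar> - b))
        \<le> C_R A \<rho> \<epsilon> * C_Phi A \<rho> \<epsilon> * norm (x0 - xs)
            / ((1 - \<rho>) * gamma_min A \<rho> \<epsilon> * sqrt (real K + 1))"
    using bound by (simp add: mult.assoc)
qed

end
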